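(* Let $X$ be a semilattice. The semigroup $\lambda(X)$ is commutative if and only if $X$ is a bush with finite branches (that is, $X$ is a bush and every branch of $X$ is finite).
   Context: A semilattice is a commutative semigroup with $xx=x$ for all $x$; it is partially ordered by $x\le y$ iff $xy=x$. A semilattice is linear if $xy\in\{x,y\}$ for all its elements $x,y$. A semilattice $X$ is called a bush if for any two distinct maximal (with respect to inclusion) linear subsemilattices $A,B\subset X$ the product $A*B=\{ab:a\in A,\ b\in B\}$ is the singleton $\{\min X\}$ containing the smallest element $\min X$ of $X$ (in particular this smallest element exists whenever such distinct $A,B$ exist). A branch of a bush $X$ is a maximal linear subsemilattice of $X$. For a set $X$, an upfamily on $X$ is a non-empty family $\mathcal F$ of non-empty subsets of $X$ such that $A\in\mathcal F$ and $A\subset B\subset X$ imply $B\in\mathcal F$. For a family $\mathcal B$ of subsets of $X$, $\langle\mathcal B\rangle=\{A\subset X:\exists B\in\mathcal B,\ B\subset A\}$. An upfamily $\mathcal A$ is linked if $A\cap B\neq\emptyset$ for all $A,B\in\mathcal A$; maximal linked if it is linked and is not properly contained in another linked upfamily. The superextension $\lambda(X)$ is the set of all maximal linked upfamilies on $X$. If $X$ is a semigroup, $\lambda(X)$ is a semigroup under the operation $\mathcal U*\mathcal V=\big\langle\bigcup_{x\in U}xV_x: U\in\mathcal U,\ (V_x)_{x\in U}\in\mathcal V^U\big\rangle$. *)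

theory Defs
  imports Main
begin

text \<open>
  A semilattice is given by a type \<open>'a\<close> together with a multiplication \<open>f\<close> satisfying the
  locale predicate \<^locale>\<open>semilattice\<close> (associative, commutative and idempotent); the
  underlying set is all of \<open>'a\<close>.
\<close>

definition sl_le :: "('a \<Rightarrow> 'a \<Rightarrow> 'a) \<Rightarrow> 'a \<Rightarrow> 'a \<Rightarrow> bool" where
  "sl_le f x y \<longleftrightarrow> f x y = x"

definition is_least :: "('a \<Rightarrow> 'a \<Rightarrow> 'a) \<Rightarrow> 'a \<Rightarrow> bool" where
  "is_least f m \<longleftrightarrow> (\<forall>x. sl_le f m x)"

definition subsemilattice :: "('a \<Rightarrow> 'a \<Rightarrow> 'a) \<Rightarrow> 'a set \<Rightarrow> bool" where
  "subsemilattice f A \<longleftrightarrow> A \<noteq> {} \<and> (\<forall>x\<in>A. \<forall>y\<in>A. f x y \<in> A)"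

definition linear_subsemilattice :: "('a \<Rightarrow> 'a \<Rightarrow> 'a) \<Rightarrow> 'a set \<Rightarrow> bool" where
  "linear_subsemilattice f A \<longleftrightarrow>
     subsemilattice f A \<and> (\<forall>x\<in>A. \<forall>y\<in>A. f x y \<in> {x, y})"

definition branch :: "('a \<Rightarrow> 'a \<Rightarrow> 'a) \<Rightarrow> 'a set \<Rightarrow> bool" where
  "branch f A \<longleftrightarrow>
     linear_subsemilattice f A \<and> (\<forall>B. linear_subsemilattice f B \<and> A \<subseteq> B \<longrightarrow> B = A)"

definition set_mult :: "('a \<Rightarrow> 'a \<Rightarrow> 'a) \<Rightarrow> 'a set \<Rightarrow> 'a set \<Rightarrow> 'a set" where
  "set_mult f A B = {f a b | a b. a \<in> A \<and> b \<in> B}"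

text \<open>
  The smallest element is only required to exist when there are two distinct branches.
\<close>

definition bush :: "('a \<Rightarrow> 'a \<Rightarrow> 'a) \<Rightarrow> bool" where
  "bush f \<longleftrightarrow>
     (\<forall>A B. branch f A \<and> branch f B \<and> A \<noteq> B \<longrightarrow> (\<exists>m. is_least f m \<and> set_mult f A B = {m}))"

definition upfamily :: "'a set set \<Rightarrow> bool" where
  "upfamily F \<longleftrightarrow> F \<noteq> {} \<and> {} \<notin> F \<and> (\<forall>A B. A \<in> F \<and> A \<subseteq> B \<longrightarrow> B \<in> F)"

definition up_closure :: "'a set set \<Rightarrow> 'a set set" where
  "up_closure \<B> = {A. \<exists>B\<in>\<B>. B \<subseteq> A}"

definition linked :: "'a set set \<Rightarrow> bool" where
  "linked F \<longleftrightarrow> (\<forall>A\<in>F. \<forall>B\<in>F. A \<inter> B \<noteq> {})"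

definition maximal_linked :: "'a set set \<Rightarrow> bool" where
  "maximal_linked F \<longleftrightarrow>
     upfamily F \<and> linked F \<and> \<not> (\<exists>G. upfamily G \<and> linked G \<and> F \<subset> G)"

definition superextension :: "'a set set set" where
  "superextension = {F. maximal_linked F}"

text \<open>
  Only the values of the choice function \<open>W\<close> on \<open>U\<close> matter, so it may be taken total.
\<close>

definition ext_mult :: "('a \<Rightarrow> 'a \<Rightarrow> 'a) \<Rightarrow> 'a set set \<Rightarrow> 'a set set \<Rightarrow> 'a set set" where
  "ext_mult f \<U> \<V> =
     up_closure {\<Union>x\<in>U. f x ` W x | U W. U \<in> \<U> \<and> (\<forall>x\<in>U. W x \<in> \<V>)}"

end

theory Submission
  imports Defs "HOL-Library.Ramsey"
begin

text \<open>
  Two products \<open>F * G\<close> and \<open>G * F\<close> of maximal linked families are equal exactly when every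
  basic set \<open>\<Union>x\<in>U. x W\<^sub>x\<close> of the first meets every basic set \<open>\<Union>y\<in>V. y W'\<^sub>y\<close> of the second:
  a set outside a maximal linked family has its complement inside. Since every linked family extends
  to a maximal one, commutativity of the superextension is therefore a statement about arbitrary
  linked families \<open>F\<close>, \<open>G\<close> and single members of them, here called \<open>interlocking\<close>. Explicit small
  families can be substituted into it, and no maximal family has to be handled afterwards.
  
  Necessity. Substituting two triangles of pairs yields the law \<open>xy \<in> {x, y, xz, yz}\<close> for all
  \<open>x\<close>, \<open>y\<close>, \<open>z\<close>. It says that a product of incomparable elements is the least element and that
  elements with a common upper bound are comparable, and this is equivalent to being a bush.
  Substituting the tails of the even and of the odd terms of a monotone sequence shows that no chain
  is infinite: in an increasing sequence a product picks the earlier factor, in a decreasing one the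
  later factor, so one order of multiplication sees only even terms and the other only odd terms.
  
  Sufficiency. If the least element lies in both basic sets, they meet. Otherwise one of them, say
  the second, avoids it. Then every \<open>y \<in> V\<close> is comparable to every element of \<open>W'\<^sub>y\<close>, and as
  comparability is transitive through elements that are not least, linkedness forces \<open>V\<close> and all
  \<open>W'\<^sub>y\<close> into one chain, which is finite. Alternately stepping from \<open>y \<in> V\<close> to a point of
  \<open>U \<inter> W'\<^sub>y\<close> and from \<open>x \<in> U\<close> to a point of \<open>V \<inter> W\<^sub>x\<close> must become periodic, and the least
  element of a cycle is the product with its predecessor as well as with its successor; one of these
  products is in the first basic set and the other in the second.
\<close>

section \<open>Maximal sets of pairwise related elements\<close>

text \<open>
  Used both for chains, with comparability as \<open>R\<close>, and for linked families, where \<open>R A B\<close> means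
  that \<open>A\<close> and \<open>B\<close> meet. A condition on pairs survives unions of chains, so Zorn's lemma applies.
\<close>

lemma pairwise_related_extends_to_maximal:
  assumes "\<forall>x\<in>A. \<forall>y\<in>A. R x y"
  obtains M where "A \<subseteq> M" "\<forall>x\<in>M. \<forall>y\<in>M. R x y"
    "\<And>N. M \<subseteq> N \<Longrightarrow> \<forall>x\<in>N. \<forall>y\<in>N. R x y \<Longrightarrow> N = M"
proof -
  let ?P = "{M. A \<subseteq> M \<and> (\<forall>x\<in>M. \<forall>y\<in>M. R x y)}"
  have "\<exists>M\<in>?P. \<forall>N\<in>?P. M \<subseteq> N \<longrightarrow> N = M"
  proof (rule subset_Zorn_nonempty)
    show "?P \<noteq> {}" using assms by auto
    fix C assume C: "C \<noteq> {}" "subset.chain ?P C"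
    have sub: "C \<subseteq> ?P" and lin: "\<And>K L. K \<in> C \<Longrightarrow> L \<in> C \<Longrightarrow> K \<subseteq> L \<or> L \<subseteq> K"
      using C(2) by (auto simp: subset_chain_def)
    have "R x y" if "x \<in> K" "K \<in> C" "y \<in> L" "L \<in> C" for x y K L
      using lin[OF that(2,4)] that sub by blast
    moreover have "A \<subseteq> \<Union>C" using C(1) sub by blast
    ultimately show "\<Union>C \<in> ?P" by auto
  qed
  then obtain M where M: "M \<in> ?P" and max: "\<forall>N\<in>?P. M \<subseteq> N \<longrightarrow> N = M" by blast
  show thesis
  proof (rule that)
    show "A \<subseteq> M" "\<forall>x\<in>M. \<forall>y\<in>M. R x y" using M by simp_all
    fix N assume N: "M \<subseteq> N" "\<forall>x\<in>N. \<forall>y\<in>N. R x y"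
    then have "N \<in> ?P" using M by (simp add: subset_trans[of A M N])
    then show "N = M" using max N(1) by blast
  qed
qed

section \<open>Commutativity as a combinatorial condition on linked families\<close>

text \<open>
  The two unions are the basic sets generating \<open>F * G\<close> and \<open>G * F\<close>. The families are only linked,
  neither maximal nor upward closed, so that finite families can be used as test cases.
\<close>

definition interlocking :: "('a \<Rightarrow> 'a \<Rightarrow> 'a) \<Rightarrow> bool" where
  "interlocking f \<longleftrightarrow>
     (\<forall>F G U V W W'. linked F \<and> linked G \<and> U \<in> F \<and> V \<in> G
        \<and> (\<forall>x\<in>U. W x \<in> G) \<and> (\<forall>y\<in>V. W' y \<in> F)
        \<longrightarrow> (\<Union>x\<in>U. f x ` W x) \<inter> (\<Union>y\<in>V. f y ` W' y) \<noteq> {})"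

lemma interlockingD:
  assumes "interlocking f" "linked F" "linked G" "U \<in> F" "V \<in> G"
    "\<forall>x\<in>U. W x \<in> G" "\<forall>y\<in>V. W' y \<in> F"
  obtains x v y u where "x \<in> U" "v \<in> W x" "y \<in> V" "u \<in> W' y" "f x v = f y u"
proof -
  have "(\<Union>x\<in>U. f x ` W x) \<inter> (\<Union>y\<in>V. f y ` W' y) \<noteq> {}"
    using assms(1)[unfolded interlocking_def, rule_format, of F G U V W W'] assms(2-) by simp
  then obtain x y where "x \<in> U" "y \<in> V" "f x ` W x \<inter> f y ` W' y \<noteq> {}" by blast
  then show thesis using that by blast
qed

lemma linkedD: "linked F \<Longrightarrow> A \<in> F \<Longrightarrow> B \<in> F \<Longrightarrow> A \<inter> B \<noteq> {}"
  unfolding linked_def by blast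

text \<open>
  A linked family that is maximal among all linked families is upward closed for free: adding a
  superset of a member keeps it linked.
\<close>

lemma linked_extends_to_maximal_linked:
  assumes "linked F" "F \<noteq> {}"
  obtains M where "F \<subseteq> M" "maximal_linked M"
proof -
  obtain M where M: "F \<subseteq> M" "linked M" and
    max: "\<And>N. M \<subseteq> N \<Longrightarrow> linked N \<Longrightarrow> N = M"
    using pairwise_related_extends_to_maximal[of F "\<lambda>A B. A \<inter> B \<noteq> {}"] assms(1)
    unfolding linked_def by metis
  have "B \<in> M" if "A \<in> M" "A \<subseteq> B" for A B
  proof -
    have "linked (insert B M)"
      using M(2) that unfolding linked_def by blast
    then show ?thesis using max[of "insert B M"] by blast
  qed
  moreover have "{} \<notin> M" using M(2) unfolding linked_def by blast
  ultimately have "upfamily M"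
    using M(1) assms(2) unfolding upfamily_def by blast
  then have "maximal_linked M"
    using M(2) max unfolding maximal_linked_def by blast
  with M(1) show thesis by (rule that)
qed

text \<open>
  If \<open>F\<close> contains neither \<open>A\<close> nor its complement, then every member of \<open>F\<close> meets \<open>A\<close>, as
  otherwise it would lie in \<open>- A\<close>. Adding all supersets of \<open>A\<close> then gives a larger linked upfamily.
\<close>

lemma maximal_linked_Compl:
  assumes "maximal_linked F" "A \<notin> F"
  shows "- A \<in> F"
proof (rule ccontr)
  assume *: "- A \<notin> F"
  have up: "\<And>B C. B \<in> F \<Longrightarrow> B \<subseteq> C \<Longrightarrow> C \<in> F" and ne: "F \<noteq> {}" "{} \<notin> F" and l: "linked F"
    using assms(1) unfolding maximal_linked_def upfamily_def by blast+
  have meet: "A \<inter> B \<noteq> {}" if "B \<in> F" for B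
    using up[OF that, of "- A"] * by blast
  have "A \<noteq> {}" using meet ne(1) by blast
  let ?G = "F \<union> {B. A \<subseteq> B}"
  have "upfamily ?G"
    using up ne \<open>A \<noteq> {}\<close> unfolding upfamily_def by blast
  moreover have "linked ?G"
    using l meet \<open>A \<noteq> {}\<close> unfolding linked_def by blast
  moreover have "F \<subset> ?G" using assms(2) by blast
  ultimately show False using assms(1) unfolding maximal_linked_def by blast
qed

text \<open>
  Two members of a product contain \<open>x y\<close> with \<open>x\<close> common to the outer sets and \<open>y\<close> common to the
  inner sets at \<open>x\<close>.
\<close>

lemma linked_ext_mult:
  assumes "linked F" "linked G"
  shows "linked (ext_mult f F G)"
  unfolding linked_def
proof (intro ballI)
  fix A B assume "A \<in> ext_mult f F G" "B \<in> ext_mult f F G"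
  then obtain U W U' W' where A: "U \<in> F" "\<forall>x\<in>U. W x \<in> G" "(\<Union>x\<in>U. f x ` W x) \<subseteq> A"
    and B: "U' \<in> F" "\<forall>x\<in>U'. W' x \<in> G" "(\<Union>x\<in>U'. f x ` W' x) \<subseteq> B"
    unfolding ext_mult_def up_closure_def by auto
  obtain x where x: "x \<in> U" "x \<in> U'"
    using assms(1) A(1) B(1) unfolding linked_def by blast
  then obtain y where "y \<in> W x" "y \<in> W' x"
    using assms(2) A(2) B(2) unfolding linked_def by blast
  then have "f x y \<in> A \<inter> B" using x A(3) B(3) by blast
  then show "A \<inter> B \<noteq> {}" by blast
qed

lemma in_ext_multI:
  assumes "U \<in> F" "\<And>x. x \<in> U \<Longrightarrow> W x \<in> G" "(\<Union>x\<in>U. f x ` W x) \<subseteq> A"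
  shows "A \<in> ext_mult f F G"
proof -
  have "(\<Union>x\<in>U. f x ` W x) \<in> {\<Union>x\<in>U. f x ` W x | U W. U \<in> F \<and> (\<forall>x\<in>U. W x \<in> G)}"
    using assms(1,2) by (intro CollectI exI[of _ U] exI[of _ W]) simp
  with assms(3) have "\<exists>B\<in>{\<Union>x\<in>U. f x ` W x | U W. U \<in> F \<and> (\<forall>x\<in>U. W x \<in> G)}. B \<subseteq> A"
    by (rule bexI)
  then show ?thesis
    unfolding ext_mult_def up_closure_def by (rule CollectI)
qed

text \<open>
  The family \<open>G * F\<close> consists of the sets \<open>A\<close> for which \<open>{y. f y -` A \<in> F}\<close> lies in \<open>G\<close>. Since
  complements can be taken in both \<open>F\<close> and \<open>G\<close>, failure of this for \<open>A\<close> puts a basic set of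
  \<open>G * F\<close> inside \<open>- A\<close>, which contradicts interlocking with a basic set of \<open>F * G\<close> inside \<open>A\<close>.
\<close>

lemma ext_mult_subset_swap:
  assumes "interlocking f" "maximal_linked F" "maximal_linked G"
  shows "ext_mult f F G \<subseteq> ext_mult f G F"
proof
  fix A assume "A \<in> ext_mult f F G"
  then obtain U W where A: "U \<in> F" "\<forall>x\<in>U. W x \<in> G" "(\<Union>x\<in>U. f x ` W x) \<subseteq> A"
    unfolding ext_mult_def up_closure_def by blast
  have l: "linked F" "linked G"
    using assms(2,3) unfolding maximal_linked_def by auto
  let ?S = "{y. f y -` A \<in> F}"
  show "A \<in> ext_mult f G F"
  proof (cases "?S \<in> G")
    case True
    then show ?thesis by (intro in_ext_multI[of ?S G "\<lambda>y. f y -` A" F]) auto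
  next
    case False
    then have S: "- ?S \<in> G" by (rule maximal_linked_Compl[OF assms(3)])
    have "\<forall>y\<in>- ?S. f y -` (- A) \<in> F"
      using maximal_linked_Compl[OF assms(2)] by (simp add: vimage_Compl)
    then obtain x v y u where "x \<in> U" "v \<in> W x" "y \<in> - ?S" "u \<in> f y -` (- A)" "f x v = f y u"
      by (rule interlockingD[OF assms(1) l A(1) S A(2)])
    then have "f x v \<in> (\<Union>x\<in>U. f x ` W x)" "f x v \<notin> A"
      by (blast, simp)
    then show ?thesis using A(3) by blast
  qed
qed

text \<open>
  From left to right, two basic sets belong to the same product of maximal linked extensions, and
  that product is linked.
\<close>

theorem superextension_commutative_iff_interlocking:
  "(\<forall>F\<in>superextension. \<forall>G\<in>superextension. ext_mult f F G = ext_mult f G F)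
     \<longleftrightarrow> interlocking f" (is "?comm \<longleftrightarrow> _")
proof
  assume comm: ?comm
  show "interlocking f"
    unfolding interlocking_def
  proof (intro allI impI, elim conjE)
    fix F G :: "'a set set" and U V W W'
    assume F: "linked F" "U \<in> F" "\<forall>y\<in>V. W' y \<in> F"
      and G: "linked G" "V \<in> G" "\<forall>x\<in>U. W x \<in> G"
    have "F \<noteq> {}" "G \<noteq> {}" using F(2) G(2) by auto
    obtain M where M: "F \<subseteq> M" "maximal_linked M"
      using F(1) \<open>F \<noteq> {}\<close> by (rule linked_extends_to_maximal_linked)
    obtain N where N: "G \<subseteq> N" "maximal_linked N"
      using G(1) \<open>G \<noteq> {}\<close> by (rule linked_extends_to_maximal_linked)
    have "(\<Union>x\<in>U. f x ` W x) \<in> ext_mult f M N"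
      using F G M(1) N(1) by (intro in_ext_multI[of U M W N]) auto
    moreover have "(\<Union>y\<in>V. f y ` W' y) \<in> ext_mult f N M"
      using F G M(1) N(1) by (intro in_ext_multI[of V N W' M]) auto
    moreover have "ext_mult f N M = ext_mult f M N"
      using comm M(2) N(2) unfolding superextension_def by blast
    moreover have "linked (ext_mult f M N)"
      using M(2) N(2) by (intro linked_ext_mult) (simp_all add: maximal_linked_def)
    ultimately show "(\<Union>x\<in>U. f x ` W x) \<inter> (\<Union>y\<in>V. f y ` W' y) \<noteq> {}"
      by (intro linkedD[of "ext_mult f M N"]) simp_all
  qed
next
  assume "interlocking f"
  then show ?comm
    using ext_mult_subset_swap unfolding superextension_def by blast
qed

section \<open>An equational description of bushes\<close>

text \<open>
  A bush without reference to branches: if \<open>x\<close> and \<open>y\<close> are incomparable, then \<open>z\<close> below \<open>x y\<close>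
  shows that \<open>x y\<close> is least, while \<open>z\<close> above both shows that this case cannot occur.
\<close>

definition bush_law :: "('a \<Rightarrow> 'a \<Rightarrow> 'a) \<Rightarrow> bool" where
  "bush_law f \<longleftrightarrow> (\<forall>x y z. f x y \<in> {x, y, f x z, f y z})"

context semilattice
begin

abbreviation le (infix "\<sqsubseteq>" 50) where
  "x \<sqsubseteq> y \<equiv> sl_le f x y"

abbreviation comparable :: "'a \<Rightarrow> 'a \<Rightarrow> bool" where
  "comparable x y \<equiv> x \<sqsubseteq> y \<or> y \<sqsubseteq> x"

lemma le_refl: "x \<sqsubseteq> x"
  by (simp add: sl_le_def)

lemma le_trans: "x \<sqsubseteq> y \<Longrightarrow> y \<sqsubseteq> z \<Longrightarrow> x \<sqsubseteq> z"
  unfolding sl_le_def by (metis assoc)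

lemma le_antisym: "x \<sqsubseteq> y \<Longrightarrow> y \<sqsubseteq> x \<Longrightarrow> x = y"
  unfolding sl_le_def by (metis commute)

lemma mult_le: "x \<^bold>* y \<sqsubseteq> x" "x \<^bold>* y \<sqsubseteq> y"
  unfolding sl_le_def by (simp_all add: ac_simps)

lemma le_multI: "z \<sqsubseteq> x \<Longrightarrow> z \<sqsubseteq> y \<Longrightarrow> z \<sqsubseteq> x \<^bold>* y"
  unfolding sl_le_def by (metis assoc)

lemma le_imp_mult_eq: "x \<sqsubseteq> y \<Longrightarrow> x \<^bold>* y = x" "x \<sqsubseteq> y \<Longrightarrow> y \<^bold>* x = x"
  unfolding sl_le_def by (auto simp: commute)

lemma comparable_iff: "comparable x y \<longleftrightarrow> x \<^bold>* y \<in> {x, y}"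
  unfolding sl_le_def by (auto simp: commute)

lemma is_least_unique: "is_least f m \<Longrightarrow> is_least f n \<Longrightarrow> m = n"
  unfolding is_least_def by (blast intro: le_antisym)

lemma is_least_down: "is_least f m \<Longrightarrow> n \<sqsubseteq> m \<Longrightarrow> is_least f n"
  unfolding is_least_def by (blast intro: le_trans)

lemma linear_subsemilattice_iff:
  "linear_subsemilattice f A \<longleftrightarrow> A \<noteq> {} \<and> (\<forall>x\<in>A. \<forall>y\<in>A. comparable x y)"
proof -
  have "x \<^bold>* y \<in> A" if "\<forall>x\<in>A. \<forall>y\<in>A. comparable x y" "x \<in> A" "y \<in> A" for x y
  proof -
    have "x \<^bold>* y = x \<or> x \<^bold>* y = y" using that unfolding comparable_iff by blast
    then show ?thesis using that(2,3) by auto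
  qed
  then show ?thesis
    unfolding linear_subsemilattice_def subsemilattice_def comparable_iff[symmetric] by blast
qed

lemma linear_extends_to_branch:
  assumes "A \<noteq> {}" "\<forall>x\<in>A. \<forall>y\<in>A. comparable x y"
  obtains B where "branch f B" "A \<subseteq> B"
proof -
  obtain B where "A \<subseteq> B" "\<forall>x\<in>B. \<forall>y\<in>B. comparable x y"
    "\<And>N. B \<subseteq> N \<Longrightarrow> \<forall>x\<in>N. \<forall>y\<in>N. comparable x y \<Longrightarrow> N = B"
    using pairwise_related_extends_to_maximal[of A comparable] assms(2) by metis
  then have "branch f B" "A \<subseteq> B"
    using assms(1) unfolding branch_def linear_subsemilattice_iff by auto
  then show thesis by (rule that)
qed

lemma comparable_extends_to_branch:
  assumes "comparable x y"
  obtains B where "branch f B" "x \<in> B" "y \<in> B"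
proof -
  have "\<forall>a\<in>{x, y}. \<forall>b\<in>{x, y}. comparable a b" using assms le_refl by blast
  from linear_extends_to_branch[OF insert_not_empty this]
  obtain B where "branch f B" "{x, y} \<subseteq> B" .
  then show thesis using that[of B] by simp
qed

lemma branch_comparable: "branch f A \<Longrightarrow> x \<in> A \<Longrightarrow> y \<in> A \<Longrightarrow> comparable x y"
  unfolding branch_def linear_subsemilattice_iff by blast

lemma distinct_branches_incomparable:
  assumes "branch f A" "branch f B" "A \<noteq> B"
  obtains a b where "a \<in> A" "b \<in> B" "\<not> comparable a b"
proof (rule ccontr)
  assume "\<not> thesis"
  with that have "\<forall>a\<in>A. \<forall>b\<in>B. comparable a b" by blast
  then have "\<forall>x\<in>A \<union> B. \<forall>y\<in>A \<union> B. comparable x y"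
    using branch_comparable[OF assms(1)] branch_comparable[OF assms(2)] by (meson UnE)
  moreover have "A \<noteq> {}"
    using assms(1) unfolding branch_def linear_subsemilattice_iff by (elim conjE)
  ultimately have "linear_subsemilattice f (A \<union> B)"
    unfolding linear_subsemilattice_iff by simp
  then have "A \<union> B = A" "A \<union> B = B"
    using assms(1,2) unfolding branch_def by (meson Un_upper1 Un_upper2)+
  then show False using assms(3) by simp
qed

lemma bush_law_mult_least:
  assumes "bush_law f" "\<not> comparable x y"
  shows "is_least f (x \<^bold>* y)"
  unfolding is_least_def
proof
  fix z
  have "x \<^bold>* y \<in> {x \<^bold>* z, y \<^bold>* z}"
    using assms unfolding bush_law_def comparable_iff by blast
  then show "x \<^bold>* y \<sqsubseteq> z" using mult_le(2) by auto
qed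

lemma bush_law_upper_bound:
  assumes "bush_law f" "x \<sqsubseteq> z" "y \<sqsubseteq> z"
  shows "comparable x y"
proof -
  have "x \<^bold>* y \<in> {x, y, x \<^bold>* z, y \<^bold>* z}"
    using assms(1) unfolding bush_law_def by blast
  then show ?thesis using assms(2,3) unfolding comparable_iff by (auto simp: le_imp_mult_eq)
qed

text \<open>
  If \<open>y\<close> bounds \<open>x\<close> and \<open>z\<close> from above, they are comparable by the law; if it bounds incomparable
  \<open>x\<close> and \<open>z\<close> from below, it is below their product, which is least. So the non-least elements fall
  into disjoint chains under comparability.
\<close>

lemma bush_law_comparable_trans:
  assumes "bush_law f" "comparable x y" "comparable y z" "\<not> is_least f y"
  shows "comparable x z"
proof (rule ccontr)
  assume inc: "\<not> comparable x z"
  consider "x \<sqsubseteq> y" "z \<sqsubseteq> y" | "y \<sqsubseteq> x" "y \<sqsubseteq> z"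
    using assms(2,3) inc le_trans by blast
  then show False
  proof cases
    case 1
    then show False using bush_law_upper_bound[OF assms(1)] inc by blast
  next
    case 2
    then have "y \<sqsubseteq> x \<^bold>* z" by (rule le_multI)
    then show False using bush_law_mult_least[OF assms(1) inc] is_least_down assms(4) by blast
  qed
qed

text \<open>
  From left to right, incomparable \<open>x\<close> and \<open>y\<close> lie in distinct branches, and each branch may be
  chosen to contain one further element comparable to \<open>x\<close> or \<open>y\<close>; the law follows by comparing \<open>z\<close>
  with \<open>x\<close> and \<open>y\<close>. Conversely, two distinct branches contain incomparable elements. If an element
  \<open>a\<close> of the first is below an element of the second, then \<open>a\<close> must be least: otherwise transitivity
  of comparability through \<open>a\<close> would make those incomparable elements comparable.
\<close>

lemma bush_iff_bush_law: "bush f \<longleftrightarrow> bush_law f"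
proof
  assume bush: "bush f"
  \<comment> \<open>Apply the bush property to branches through \<open>{x, a}\<close> and \<open>{y, b}\<close>; they differ as \<open>x\<close>, \<open>y\<close> are incomparable.\<close>
  have split: "is_least f (a \<^bold>* b)"
    if xa: "comparable x a" and yb: "comparable y b" and inc: "\<not> comparable x y" for x y a b
  proof -
    obtain A where A: "branch f A" "x \<in> A" "a \<in> A"
      using comparable_extends_to_branch[OF xa] by blast
    obtain B where B: "branch f B" "y \<in> B" "b \<in> B"
      using comparable_extends_to_branch[OF yb] by blast
    have "A \<noteq> B" using branch_comparable[OF A(1)] A(2) B(2) inc by blast
    then obtain m where "is_least f m" "set_mult f A B = {m}"
      using bush A(1) B(1) unfolding bush_def by blast
    moreover have "a \<^bold>* b \<in> set_mult f A B"
      using A(3) B(3) unfolding set_mult_def by blast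
    ultimately show ?thesis by simp
  qed
  show "bush_law f"
    unfolding bush_law_def
  proof (intro allI)
    fix x y z
    show "x \<^bold>* y \<in> {x, y, x \<^bold>* z, y \<^bold>* z}"
    proof (cases "comparable x y")
      case True
      then show ?thesis unfolding comparable_iff by blast
    next
      case False
      then have least: "is_least f (x \<^bold>* y)" using split le_refl by blast
      have xz: ?thesis if "is_least f (x \<^bold>* z)"
        using is_least_unique[OF least that] by simp
      have yz: ?thesis if "is_least f (y \<^bold>* z)"
        using is_least_unique[OF least that] by simp
      consider "\<not> comparable x z" | "\<not> comparable y z" | "z \<sqsubseteq> x" "z \<sqsubseteq> y" | "x \<sqsubseteq> z" "y \<sqsubseteq> z"
        using False le_trans by blast
      then show ?thesis
      proof cases
        case 1
        then show ?thesis using split le_refl xz by blast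
      next
        case 2
        then show ?thesis using split le_refl yz by blast
      next
        case 3
        then have "is_least f z" using least is_least_down le_multI by blast
        then show ?thesis using 3(1) xz by (simp add: le_imp_mult_eq)
      next
        case 4
        \<comment> \<open>Branches through \<open>{x, z}\<close> and \<open>{y, z}\<close> share \<open>z\<close>, so \<open>z = z z\<close> is least.\<close>
        then have "is_least f (z \<^bold>* z)" using split False by blast
        then show ?thesis using 4(1) xz is_least_down by (auto simp: le_imp_mult_eq)
      qed
    qed
  qed
next
  assume law: "bush_law f"
  \<comment> \<open>Comparability passes from \<open>b'\<close> through \<open>b\<close> to \<open>a\<close> and then to \<open>a'\<close>, unless \<open>a\<close> is least.\<close>
  have below: "is_least f a"
    if A: "branch f A" "a \<in> A" "a' \<in> A" and B: "branch f B" "b \<in> B" "b' \<in> B"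
      and inc: "\<not> comparable a' b'" and ab: "a \<sqsubseteq> b" for A B a a' b b'
  proof (rule ccontr)
    assume a: "\<not> is_least f a"
    then have "\<not> is_least f b" using is_least_down ab by blast
    then have "comparable a b'"
      using bush_law_comparable_trans[OF law, of a b b'] ab branch_comparable[OF B] by blast
    then show False
      using bush_law_comparable_trans[OF law, of a' a b'] a branch_comparable[OF A] inc by blast
  qed
  show "bush f"
    unfolding bush_def
  proof (intro allI impI, elim conjE)
    fix A B assume AB: "branch f A" "branch f B" "A \<noteq> B"
    then obtain a' b' where ab': "a' \<in> A" "b' \<in> B" "\<not> comparable a' b'"
      by (rule distinct_branches_incomparable)
    have least: "is_least f (a \<^bold>* b)" if "a \<in> A" "b \<in> B" for a b
    proof -
      consider "\<not> comparable a b" | "a \<sqsubseteq> b" | "b \<sqsubseteq> a" by blast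
      then show ?thesis
      proof cases
        case 1
        then show ?thesis by (rule bush_law_mult_least[OF law])
      next
        case 2
        then show ?thesis
          using below[OF AB(1) that(1) ab'(1) AB(2) that(2) ab'(2,3)] by (simp add: le_imp_mult_eq)
      next
        case 3
        then show ?thesis
          using below[OF AB(2) that(2) ab'(2) AB(1) that(1) ab'(1)] ab'(3)
          by (auto simp: le_imp_mult_eq)
      qed
    qed
    have "set_mult f A B = {a' \<^bold>* b'}"
      using is_least_unique[OF least least[OF ab'(1,2)]] ab'(1,2)
      unfolding set_mult_def by blast
    then show "\<exists>m. is_least f m \<and> set_mult f A B = {m}"
      using least[OF ab'(1,2)] by blast
  qed
qed

section \<open>Interlocking forces the bush law and finite chains\<close>

lemma linked_triangle: "linked {{a, b}, {b, c}, {a, c}}"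
  unfolding linked_def by auto

text \<open>
  Let \<open>w = x y\<close> and test interlocking on the triangles over \<open>{x, y, z}\<close> and \<open>{x, y, w}\<close>, with
  \<open>{x, y}\<close> as outer set on both sides. In the second triangle \<open>x\<close> is assigned the side avoiding \<open>x\<close>
  and \<open>y\<close> the side avoiding \<open>y\<close>, so that all products on the left equal \<open>w\<close>. In the first triangle
  \<open>x\<close> and \<open>y\<close> are assigned the sides containing them, so that the products on the right are
  \<open>x\<close>, \<open>y\<close>, \<open>x z\<close> and \<open>y z\<close>.
\<close>

lemma interlocking_imp_bush_law:
  assumes "interlocking f"
  shows "bush_law f"
  unfolding bush_law_def
proof (intro allI)
  fix x y z
  let ?w = "x \<^bold>* y"
  show "?w \<in> {x, y, x \<^bold>* z, y \<^bold>* z}"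
  proof (cases "x = y")
    case True
    then show ?thesis by simp
  next
    case False
    let ?F = "{{x, y}, {y, z}, {x, z}}" and ?G = "{{x, y}, {y, ?w}, {x, ?w}}"
    let ?W = "\<lambda>t. if t = x then {y, ?w} else {x, ?w}"
    let ?W' = "\<lambda>t. if t = x then {x, z} else {y, z}"
    have "{x, y} \<in> ?F" "{x, y} \<in> ?G" "\<forall>t\<in>{x, y}. ?W t \<in> ?G"
      "\<forall>t\<in>{x, y}. ?W' t \<in> ?F" by simp_all
    then obtain s v t u where st: "s \<in> {x, y}" "v \<in> ?W s" "t \<in> {x, y}" "u \<in> ?W' t"
      and eq: "s \<^bold>* v = t \<^bold>* u"
      by (rule interlockingD[OF assms linked_triangle linked_triangle])
    have "s \<^bold>* v = ?w"
      using st(1,2) False by (auto simp: ac_simps split: if_splits)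
    moreover have "t \<^bold>* u \<in> {x, y, x \<^bold>* z, y \<^bold>* z}"
      using st(3,4) False by (auto split: if_splits)
    ultimately show ?thesis using eq by simp
  qed
qed

text \<open>
  Ramsey's theorem for pairs of indices of an injective sequence in the chain, coloured by whether
  the pair is in increasing order.
\<close>

lemma infinite_chain_contains_monotone_sequence:
  assumes "infinite C" "\<forall>x\<in>C. \<forall>y\<in>C. comparable x y"
  obtains q :: "nat \<Rightarrow> 'a" where "inj q"
    "(\<forall>i j. i < j \<longrightarrow> q i \<sqsubseteq> q j) \<or> (\<forall>i j. i < j \<longrightarrow> q j \<sqsubseteq> q i)"
proof -
  obtain p :: "nat \<Rightarrow> 'a" where p: "inj p" "range p \<subseteq> C"
    using infinite_countable_subset[OF assms(1)] by blast
  let ?c = "\<lambda>S. if p (Min S) \<sqsubseteq> p (Max S) then 0 else 1 :: nat"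
  have "\<exists>Y t. Y \<subseteq> UNIV \<and> infinite Y \<and> t < 2 \<and> (\<forall>i\<in>Y. \<forall>j\<in>Y. i \<noteq> j \<longrightarrow> ?c {i, j} = t)"
    by (rule Ramsey2) auto
  then obtain Y t where Y: "infinite Y" "t < 2"
    and col: "\<And>i j. i \<in> Y \<Longrightarrow> j \<in> Y \<Longrightarrow> i \<noteq> j \<Longrightarrow> ?c {i, j} = t" by metis
  have e: "strict_mono (enumerate Y)" "\<And>n. enumerate Y n \<in> Y"
    using Y(1) by (simp_all add: strict_mono_enumerate enumerate_in_set)
  let ?q = "p \<circ> enumerate Y"
  have "inj ?q"
    using p(1) strict_mono_imp_inj_on[OF e(1)] by (rule inj_compose)
  moreover have step: "if t = 0 then ?q i \<sqsubseteq> ?q j else ?q j \<sqsubseteq> ?q i" if "i < j" for i j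
  proof -
    have lt: "enumerate Y i < enumerate Y j" using e(1) that by (simp add: strict_mono_def)
    then have "(if ?q i \<sqsubseteq> ?q j then 0 else 1) = t"
      using col[OF e(2) e(2), of i j] by (simp add: min_def max_def)
    moreover have "?q i \<in> C" "?q j \<in> C" using p(2) by auto
    then have "comparable (?q i) (?q j)" using assms(2) by blast
    ultimately show ?thesis by (auto split: if_splits)
  qed
  ultimately show thesis using that[of ?q] by (cases "t = 0") auto
qed

text \<open>
  Along a monotone sequence \<open>q\<close> take the tails of even-indexed terms for \<open>F\<close> and of odd-indexed
  terms for \<open>G\<close>, and let the inner set at \<open>q k\<close> start beyond \<open>k\<close>. A common product would be
  \<open>q a q b = q c q d\<close> with \<open>a < b\<close>, \<open>c < d\<close>, where \<open>a\<close>, \<open>d\<close> are even and \<open>b\<close>, \<open>c\<close> are odd. By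
  monotonicity it identifies either the two earlier or the two later factors, against parity.
\<close>

lemma interlocking_imp_finite_chain:
  assumes "interlocking f" "\<forall>x\<in>C. \<forall>y\<in>C. comparable x y"
  shows "finite C"
proof (rule ccontr)
  assume "infinite C"
  then obtain q :: "nat \<Rightarrow> 'a" where inj: "inj q"
    and mono: "(\<forall>i j. i < j \<longrightarrow> q i \<sqsubseteq> q j) \<or> (\<forall>i j. i < j \<longrightarrow> q j \<sqsubseteq> q i)"
    using infinite_chain_contains_monotone_sequence assms(2) by blast
  define E where "E n = q ` {k. even k \<and> n < k}" for n
  define D where "D n = q ` {k. odd k \<and> n < k}" for n
  define i where "i = inv q"
  have i: "i (q k) = k" for k unfolding i_def using inj by simp
  have "q (2 * (m + n) + 2) \<in> E m \<inter> E n" "q (2 * (m + n) + 1) \<in> D m \<inter> D n" for m n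
    unfolding E_def D_def by auto
  then have l: "linked (range E)" "linked (range D)"
    unfolding linked_def by blast+
  obtain x v y u where xy: "x \<in> E 0" "v \<in> D (i x)" "y \<in> D 0" "u \<in> E (i y)"
    and eq: "x \<^bold>* v = y \<^bold>* u"
    using interlockingD[OF assms(1) l rangeI rangeI, where W = "\<lambda>x. D (i x)"
        and W' = "\<lambda>y. E (i y)"] by blast
  obtain a where a: "x = q a" "even a" using xy(1) unfolding E_def by blast
  obtain b where b: "v = q b" "odd b" "a < b" using xy(2) a i unfolding D_def by auto
  obtain c where c: "y = q c" "odd c" using xy(3) unfolding D_def by blast
  obtain d where d: "u = q d" "even d" "c < d" using xy(4) c i unfolding E_def by auto
  from mono have "q a = q c \<or> q b = q d"
  proof
    assume "\<forall>i j. i < j \<longrightarrow> q i \<sqsubseteq> q j"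
    then show ?thesis using eq a b c d by (auto simp: le_imp_mult_eq)
  next
    assume "\<forall>i j. i < j \<longrightarrow> q j \<sqsubseteq> q i"
    then show ?thesis using eq a b c d by (auto simp: le_imp_mult_eq)
  qed
  then have "a = c \<or> b = d" using inj by (auto dest: injD)
  then show False using a b c d by auto
qed

section \<open>The bush law and finite chains force interlocking\<close>

text \<open>
  Iterating the image shrinks a finite set until it is stable. The stable part replaces the periodic
  cycle of the alternating walk.
\<close>

lemma finite_self_map_has_recurrent_part:
  assumes "finite V" "V \<noteq> {}" "g ` V \<subseteq> V"
  obtains P where "P \<subseteq> V" "P \<noteq> {}" "g ` P = P"
proof -
  have "\<exists>P\<subseteq>V. P \<noteq> {} \<and> g ` P = P"
    using assms
  proof (induction V rule: finite_psubset_induct)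
    case (psubset V)
    show ?case
    proof (cases "g ` V = V")
      case True
      then show ?thesis using psubset.prems by blast
    next
      case False
      then have "g ` V \<subset> V" using psubset.prems(2) by (simp add: psubset_eq)
      moreover have "g ` V \<noteq> {}" "g ` g ` V \<subseteq> g ` V"
        using psubset.prems by (simp_all add: image_mono)
      ultimately obtain P where "P \<subseteq> g ` V" "P \<noteq> {}" "g ` P = P"
        using psubset.IH by metis
      then show ?thesis using psubset.prems(2) by (meson subset_trans)
    qed
  qed
  then show thesis using that by (elim exE conjE)
qed

lemma finite_chain_has_least:
  assumes "finite S" "S \<noteq> {}" "\<forall>x\<in>S. \<forall>y\<in>S. comparable x y"
  obtains m where "m \<in> S" "\<forall>x\<in>S. m \<sqsubseteq> x"
proof -
  have "\<exists>m\<in>S. \<forall>x\<in>S. m \<sqsubseteq> x"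
    using assms
  proof (induction S rule: finite_ne_induct)
    case (singleton x)
    then show ?case using le_refl by simp
  next
    case (insert x S)
    then obtain m where m: "m \<in> S" "\<forall>y\<in>S. m \<sqsubseteq> y" by auto
    show ?case
    proof (cases "x \<sqsubseteq> m")
      case True
      then show ?thesis using m le_trans le_refl by blast
    next
      case False
      then have "m \<sqsubseteq> x" using insert.prems m(1) by blast
      then show ?thesis using m by blast
    qed
  qed
  then show thesis using that by blast
qed

text \<open>
  Linkedness gives maps \<open>u\<close> from \<open>V\<close> to \<open>U\<close> and \<open>v\<close> back with \<open>u y \<in> W' y\<close> and \<open>v x \<in> W x\<close>. On a
  part \<open>P\<close> of \<open>V\<close> stable under \<open>v \<circ> u\<close>, every element of \<open>P\<close> and of \<open>u ` P\<close> is a value as well as an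
  argument of these maps. The least such element \<open>m\<close> absorbs both the argument it comes from and the
  value it is sent to; one of the two products is in the first union, the other in the second.
\<close>

lemma products_meet_in_finite_chain:
  assumes C: "finite C" "\<forall>x\<in>C. \<forall>y\<in>C. comparable x y"
    and l: "linked F" "linked G"
    and F: "U \<in> F" "\<And>y. y \<in> V \<Longrightarrow> W' y \<in> F"
    and G: "V \<in> G" "\<And>x. x \<in> U \<Longrightarrow> W x \<in> G"
    and inC: "V \<subseteq> C" "\<And>y. y \<in> V \<Longrightarrow> W' y \<subseteq> C"
  shows "(\<Union>x\<in>U. f x ` W x) \<inter> (\<Union>y\<in>V. f y ` W' y) \<noteq> {}"
proof -
  have "\<exists>v. v \<in> V \<inter> W x" if "x \<in> U" for x
    using l(2) G(1) G(2)[OF that] unfolding linked_def by blast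
  then obtain v where v: "\<And>x. x \<in> U \<Longrightarrow> v x \<in> V \<inter> W x" by metis
  have "\<exists>u. u \<in> U \<inter> W' y" if "y \<in> V" for y
    using l(1) F(1) F(2)[OF that] unfolding linked_def by blast
  then obtain u where u: "\<And>y. y \<in> V \<Longrightarrow> u y \<in> U \<inter> W' y" by metis
  have "V \<noteq> {}" using l(2) G(1) unfolding linked_def by blast
  moreover have "(v \<circ> u) ` V \<subseteq> V" using u v by fastforce
  ultimately obtain P where P: "P \<subseteq> V" "P \<noteq> {}" "(v \<circ> u) ` P = P"
    by (rule finite_self_map_has_recurrent_part[OF finite_subset[OF inC(1) C(1)]])
  let ?S = "P \<union> u ` P"
  have S: "?S \<subseteq> C" using P(1) inC u by blast
  have "?S \<noteq> {}" "\<forall>x\<in>?S. \<forall>y\<in>?S. comparable x y" using P(2) C(2) S by blast+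
  then obtain m where m: "m \<in> ?S" "\<forall>x\<in>?S. m \<sqsubseteq> x"
    by (rule finite_chain_has_least[OF finite_subset[OF S C(1)]])
  show ?thesis
  proof (cases "m \<in> P")
    case True
    then obtain y where y: "y \<in> P" "m = v (u y)" using P(3) by auto
    have "u y \<in> U" "m \<in> W (u y)" "u y \<^bold>* m = m"
      using y P(1) u v m(2) by (auto simp: le_imp_mult_eq)
    moreover have "m \<in> V" "u m \<in> W' m" "m \<^bold>* u m = m"
      using True P(1) u m(2) by (auto simp: le_imp_mult_eq)
    ultimately have "m \<in> (\<Union>x\<in>U. f x ` W x)" "m \<in> (\<Union>y\<in>V. f y ` W' y)"
      by (metis UN_I imageI)+
    then show ?thesis by blast
  next
    case False
    then obtain y where y: "y \<in> P" "m = u y" using m(1) by blast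
    have "v m \<in> P" using y P(3) by auto
    then have "m \<in> U" "v m \<in> W m" "m \<^bold>* v m = m"
      using y P(1) u v m(2) by (auto simp: le_imp_mult_eq)
    moreover have "y \<in> V" "m \<in> W' y" "y \<^bold>* m = m"
      using y P(1) u m(2) by (auto simp: le_imp_mult_eq)
    ultimately have "m \<in> (\<Union>x\<in>U. f x ` W x)" "m \<in> (\<Union>y\<in>V. f y ` W' y)"
      by (metis UN_I imageI)+
    then show ?thesis by blast
  qed
qed

text \<open>
  No product in the second union is least, while products of incomparable elements are; so each
  \<open>y \<in> V\<close> is comparable to all of \<open>W' y\<close>, and neither factor is least. As the sets \<open>W' y\<close> meet each
  other, everything is comparable to one fixed \<open>c \<in> V\<close>. Because \<open>c\<close> is not least, the elements
  comparable to it form a chain.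
\<close>

lemma products_meet_avoiding_least:
  assumes law: "bush_law f"
    and fin: "\<And>C. \<forall>x\<in>C. \<forall>y\<in>C. comparable x y \<Longrightarrow> finite C"
    and l: "linked F" "linked G"
    and F: "U \<in> F" "\<And>y. y \<in> V \<Longrightarrow> W' y \<in> F"
    and G: "V \<in> G" "\<And>x. x \<in> U \<Longrightarrow> W x \<in> G"
    and avoid: "\<And>m. is_least f m \<Longrightarrow> m \<notin> (\<Union>y\<in>V. f y ` W' y)"
  shows "(\<Union>x\<in>U. f x ` W x) \<inter> (\<Union>y\<in>V. f y ` W' y) \<noteq> {}"
proof -
  have prod: "\<not> is_least f (y \<^bold>* u)" if "y \<in> V" "u \<in> W' y" for y u
    using avoid that by blast
  have comp: "comparable y u" if "y \<in> V" "u \<in> W' y" for y u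
    using bush_law_mult_least[OF law] prod[OF that] by blast
  have nonleast: "\<not> is_least f y" "\<not> is_least f u" if "y \<in> V" "u \<in> W' y" for y u
    using prod[OF that] is_least_down mult_le by blast+
  have meet: "\<exists>u. u \<in> W' y \<inter> W' y'" if "y \<in> V" "y' \<in> V" for y y'
    using l(1) F(2) that unfolding linked_def by blast
  obtain c where c: "c \<in> V" using l(2) G(1) unfolding linked_def by blast
  let ?C = "{x. comparable x c}"
  have "\<not> is_least f c" using meet[OF c c] nonleast(1)[OF c] by blast
  then have chain: "\<forall>x\<in>?C. \<forall>y\<in>?C. comparable x y"
    using bush_law_comparable_trans[OF law, of _ c] by blast
  have V: "comparable y c" if y: "y \<in> V" for y
  proof -
    obtain u where u: "u \<in> W' y" "u \<in> W' c" using meet[OF y c] by blast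
    show ?thesis
      using bush_law_comparable_trans[OF law, of y u c] comp[OF y u(1)] comp[OF c u(2)]
        nonleast(2)[OF y u(1)] by blast
  qed
  have W': "comparable u c" if "y \<in> V" "u \<in> W' y" for y u
    using bush_law_comparable_trans[OF law, of u y c] comp[OF that] V[OF that(1)]
      nonleast(1)[OF that] by blast
  show ?thesis
    using V W' by (intro products_meet_in_finite_chain[OF fin[OF chain] chain l F G]) auto
qed

text \<open>
  Interlocking is symmetric under exchanging the two sides, so it does not matter which of the two
  unions avoids the least element. If neither does, the least element is common to both.
\<close>

lemma bush_law_finite_chains_imp_interlocking:
  assumes law: "bush_law f"
    and fin: "\<And>C. \<forall>x\<in>C. \<forall>y\<in>C. comparable x y \<Longrightarrow> finite C"
  shows "interlocking f"
  unfolding interlocking_def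
proof (intro allI impI, elim conjE)
  fix F G :: "'a set set" and U V W W'
  assume l: "linked F" "linked G" and F: "U \<in> F" "\<forall>y\<in>V. W' y \<in> F"
    and G: "V \<in> G" "\<forall>x\<in>U. W x \<in> G"
  let ?A = "\<Union>x\<in>U. f x ` W x" and ?B = "\<Union>y\<in>V. f y ` W' y"
  consider "\<And>m. is_least f m \<Longrightarrow> m \<notin> ?A" | "\<And>m. is_least f m \<Longrightarrow> m \<notin> ?B"
    | m n where "is_least f m" "is_least f n" "m \<in> ?A" "n \<in> ?B" by blast
  then show "?A \<inter> ?B \<noteq> {}"
  proof cases
    case 1
    then have "?B \<inter> ?A \<noteq> {}"
      using F G by (intro products_meet_avoiding_least[OF law fin l(2,1)]) auto
    then show ?thesis by blast
  next
    case 2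
    then show ?thesis
      using F G by (intro products_meet_avoiding_least[OF law fin l]) auto
  next
    case 3
    then show ?thesis using is_least_unique by blast
  qed
qed

theorem interlocking_iff_bush_finite_branches:
  "interlocking f \<longleftrightarrow> bush f \<and> (\<forall>A. branch f A \<longrightarrow> finite A)"
proof
  assume "interlocking f"
  then have "bush f" "\<And>A. branch f A \<Longrightarrow> finite A"
    using interlocking_imp_bush_law bush_iff_bush_law
      interlocking_imp_finite_chain branch_comparable by simp_all
  then show "bush f \<and> (\<forall>A. branch f A \<longrightarrow> finite A)" by simp
next
  assume *: "bush f \<and> (\<forall>A. branch f A \<longrightarrow> finite A)"
  have "finite C" if chain: "\<forall>x\<in>C. \<forall>y\<in>C. comparable x y" for C
  proof (cases "C = {}")
    case False
    then obtain B where "branch f B" "C \<subseteq> B"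
      using chain by (rule linear_extends_to_branch)
    then show ?thesis using * finite_subset by blast
  qed simp
  moreover have "bush_law f" using * bush_iff_bush_law by simp
  ultimately show "interlocking f"
    by (intro bush_law_finite_chains_imp_interlocking)
qed

end

theorem theorem2p7:
  fixes f :: "'a \<Rightarrow> 'a \<Rightarrow> 'a"
  assumes "semilattice f"
  shows "(\<forall>\<U>\<in>superextension. \<forall>\<V>\<in>superextension. ext_mult f \<U> \<V> = ext_mult f \<V> \<U>)
     \<longleftrightarrow> bush f \<and> (\<forall>A. branch f A \<longrightarrow> finite A)"
  using superextension_commutative_iff_interlocking
    semilattice.interlocking_iff_bush_finite_branches[OF assms] by (rule trans)

end
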